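(* Let $\mathcal{C}=\{c_1,\ldots,c_m\}$ be a collection of cliques with graph union $U$ on vertex set $V$, and let $\Gamma_J,\gamma_J$ and supports be as in the context. Let $H\subseteq V$ induce a clique in $U$. Then $H$ is a maximal clique of $U$ if and only if, for every $J\subseteq\{1,\ldots,m\}$: (1) if $J\in S(H)$ then $|\Gamma_J\cap H|=\gamma_J$; and (2) if $J\notin S(H)$ then either $\Gamma_J=\emptyset$, or $\Gamma_J\neq\emptyset$ and $\{J\}\cup S(H)$ is not an intersecting family.
   Context: A clique is identified with its vertex set. For a collection $\mathcal{C}=\{c_1,\ldots,c_m\}$ of cliques of a graph, the graph union $U$ has vertex set $V=\bigcup_{j=1}^m c_j$, and distinct $u,v\in V$ are adjacent iff $u,v\in c_j$ for some $j$. For $J\subseteq\{1,\ldots,m\}$, $\Gamma_J$ is the set of $v\in V$ with $\{j:v\in c_j\}=J$, and $\gamma_J=|\Gamma_J|$. The support of $H\subseteq V$ is $S(H)=\{J\subseteq\{1,\ldots,m\}: H\cap\Gamma_J\neq\emptyset\}$. A family $\mathcal{F}$ of subsets of $\{1,\ldots,m\}$ is intersecting if any two distinct members have nonempty intersection.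
   Formalization: The cliques c_1,…,c_m are assumed finite; for infinite cliques the claim fails (m=1, c_1=ℕ, H=ℕ∖{0} satisfies (1) and (2) but is not maximal). *)

theory Defs
  imports "Graph_Theory.Pair_Digraph"
begin

text \<open>Simple undirected graphs are symmetric loop-free digraphs whose arcs are pairs of
  vertices (locale \<open>pair_bidirected_digraph\<close>, which does not require finiteness).\<close>

definition clique :: "'a pair_pre_digraph \<Rightarrow> 'a set \<Rightarrow> bool" where
  "clique G H \<longleftrightarrow> H \<subseteq> pverts G \<and> (\<forall>u\<in>H. \<forall>v\<in>H. u \<noteq> v \<longrightarrow> (u, v) \<in> parcs G)"

definition maximal_clique :: "'a pair_pre_digraph \<Rightarrow> 'a set \<Rightarrow> bool" where
  "maximal_clique G H \<longleftrightarrow> clique G H \<and> \<not> (\<exists>K. clique G K \<and> H \<subset> K)"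

text \<open>A collection of \<open>m\<close> cliques is a family \<open>c\<close> of vertex sets, of which only the values
  at the indices in \<open>{1..m}\<close> are used.\<close>

definition graph_union :: "nat \<Rightarrow> (nat \<Rightarrow> 'a set) \<Rightarrow> 'a pair_pre_digraph" where
  "graph_union m c =
     \<lparr> pverts = (\<Union>j\<in>{1..m}. c j),
       parcs = {(u, v). u \<noteq> v \<and> (\<exists>j\<in>{1..m}. u \<in> c j \<and> v \<in> c j)} \<rparr>"

definition Gam :: "nat \<Rightarrow> (nat \<Rightarrow> 'a set) \<Rightarrow> nat set \<Rightarrow> 'a set" where
  "Gam m c J = {v \<in> pverts (graph_union m c). {j \<in> {1..m}. v \<in> c j} = J}"

definition gam :: "nat \<Rightarrow> (nat \<Rightarrow> 'a set) \<Rightarrow> nat set \<Rightarrow> nat" where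
  "gam m c J = card (Gam m c J)"

definition supp :: "nat \<Rightarrow> (nat \<Rightarrow> 'a set) \<Rightarrow> 'a set \<Rightarrow> nat set set" where
  "supp m c H = {J. J \<subseteq> {1..m} \<and> H \<inter> Gam m c J \<noteq> {}}"

definition intersecting :: "'b set set \<Rightarrow> bool" where
  "intersecting F \<longleftrightarrow> (\<forall>A\<in>F. \<forall>B\<in>F. A \<noteq> B \<longrightarrow> A \<inter> B \<noteq> {})"

lemma pair_bidirected_digraph_graph_union: "pair_bidirected_digraph (graph_union m c)"
  by unfold_locales (auto simp: graph_union_def symmetric_def sym_def arcs_ends_def arc_to_ends_def)

end

theory Submission
  imports Defs
begin

text \<open>Two distinct vertices of the graph union are adjacent iff their index sets
  \<open>{j. v \<in> c j}\<close> meet, and the index set of a vertex is never empty. Hence a set of vertices is a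
  clique iff its support is intersecting. Adding one vertex \<open>v \<in> \<Gamma>\<^sub>J\<close> to \<open>H\<close> adds just \<open>J\<close> to the
  support, and a clique is maximal iff it cannot be extended by a single vertex.\<close>

lemma Gam_subset_pverts: "Gam m c J \<subseteq> pverts (graph_union m c)"
  by (auto simp: Gam_def)

lemma Gam_index_set:
  assumes "v \<in> pverts (graph_union m c)"
  shows "v \<in> Gam m c {j \<in> {1..m}. v \<in> c j}"
  using assms by (simp add: Gam_def)

lemma finite_Gam:
  assumes "\<And>j. j \<in> {1..m} \<Longrightarrow> finite (c j)"
  shows "finite (Gam m c J)"
  by (rule finite_subset[OF Gam_subset_pverts]) (use assms in \<open>auto simp: graph_union_def\<close>)

lemma supp_eq_image:
  assumes "H \<subseteq> pverts (graph_union m c)"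
  shows "supp m c H = (\<lambda>v. {j \<in> {1..m}. v \<in> c j}) ` H"
  using assms by (auto simp: supp_def Gam_def)

lemma supp_insert:
  assumes "v \<in> Gam m c J"
  shows "supp m c (insert v H) = insert J (supp m c H)"
  using assms by (auto simp: supp_def Gam_def)

lemma clique_graph_union_iff_intersecting:
  assumes "H \<subseteq> pverts (graph_union m c)"
  shows "clique (graph_union m c) H \<longleftrightarrow> intersecting (supp m c H)"
proof -
  let ?I = "\<lambda>v. {j \<in> {1..m}. v \<in> c j}"
  have arc: "(u, v) \<in> parcs (graph_union m c) \<longleftrightarrow> u \<noteq> v \<and> ?I u \<inter> ?I v \<noteq> {}" for u v
    by (auto simp: graph_union_def)
  have nonempty: "?I v \<noteq> {}" if "v \<in> H" for v
  proof -
    have "v \<in> (\<Union>j\<in>{1..m}. c j)"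
      using that assms by (auto simp: graph_union_def simp del: UN_iff)
    then show ?thesis by blast
  qed
  have "clique (graph_union m c) H \<longleftrightarrow>
      (\<forall>u\<in>H. \<forall>v\<in>H. u \<noteq> v \<longrightarrow> ?I u \<inter> ?I v \<noteq> {})"
    using assms unfolding clique_def arc by blast
  \<comment> \<open>An intersecting family constrains only distinct members, so two different
    vertices with the same index set drop out of the condition. Nothing is lost: their common index
    set is nonempty, so they are adjacent anyway.\<close>
  also have "\<dots> \<longleftrightarrow> (\<forall>u\<in>H. \<forall>v\<in>H. ?I u \<noteq> ?I v \<longrightarrow> ?I u \<inter> ?I v \<noteq> {})"
  proof (intro ball_cong refl)
    fix u v assume "u \<in> H" "v \<in> H"
    then show "(u \<noteq> v \<longrightarrow> ?I u \<inter> ?I v \<noteq> {}) \<longleftrightarrow> (?I u \<noteq> ?I v \<longrightarrow> ?I u \<inter> ?I v \<noteq> {})"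
      using nonempty[of u] by (cases "?I u = ?I v") (simp_all only: Int_absorb simp_thms, metis)
  qed
  also have "\<dots> \<longleftrightarrow> intersecting (supp m c H)"
    unfolding supp_eq_image[OF assms] intersecting_def by (simp only: ball_simps)
  finally show ?thesis .
qed

lemma clique_subset: "clique G K \<Longrightarrow> H \<subseteq> K \<Longrightarrow> clique G H"
  unfolding clique_def by blast

text \<open>If a clique \<open>K\<close> properly contains \<open>H\<close>, pick \<open>v\<close>
  in \<open>K - H\<close>: then \<open>insert v H\<close> lies inside \<open>K\<close>, and subsets
  of cliques are cliques.\<close>

lemma maximal_clique_iff_no_insert:
  "maximal_clique G H \<longleftrightarrow> clique G H \<and> (\<forall>v\<in>pverts G - H. \<not> clique G (insert v H))"
proof -
  have "\<exists>v\<in>pverts G - H. clique G (insert v H)" if K: "clique G K" "H \<subset> K" for K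
  proof -
    obtain v where v: "v \<in> K" "v \<notin> H" using K(2) by blast
    moreover have "clique G (insert v H)"
      using v K by (intro clique_subset[OF K(1)]) auto
    ultimately show ?thesis using K(1) by (auto simp: clique_def)
  qed
  then show ?thesis unfolding maximal_clique_def by blast
qed

theorem theorem4p13:
  fixes G :: "'a pair_pre_digraph" and c :: "nat \<Rightarrow> 'a set" and m :: nat and H :: "'a set"
  assumes "pair_bidirected_digraph G"
    and "\<And>j. j \<in> {1..m} \<Longrightarrow> clique G (c j)"
    and "\<And>j. j \<in> {1..m} \<Longrightarrow> finite (c j)"
    and "H \<subseteq> pverts (graph_union m c)"
    and "clique (graph_union m c) H"
  shows "maximal_clique (graph_union m c) H \<longleftrightarrow>
    (\<forall>J. J \<subseteq> {1..m} \<longrightarrow>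
      (J \<in> supp m c H \<longrightarrow> card (Gam m c J \<inter> H) = gam m c J) \<and>
      (J \<notin> supp m c H \<longrightarrow>
        Gam m c J = {} \<or>
        (Gam m c J \<noteq> {} \<and> \<not> intersecting ({J} \<union> supp m c H))))"
proof -
  let ?U = "graph_union m c" and ?S = "supp m c H"
  have S: "intersecting ?S"
    using assms(4,5) by (simp add: clique_graph_union_iff_intersecting)
  have ins: "clique ?U (insert v H) \<longleftrightarrow> intersecting (insert J ?S)" if "v \<in> Gam m c J" for v J
    using that assms(4) Gam_subset_pverts[of m c J]
    by (subst clique_graph_union_iff_intersecting) (auto simp: supp_insert)
  \<comment> \<open>Finiteness matters here: \<open>card\<close> is 0 on infinite sets, so equal
    cardinalities force \<open>Gam m c J \<inter> H\<close> to be all of \<open>Gam m c J\<close>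
    only when the latter is finite.\<close>
  have full: "card (Gam m c J \<inter> H) = gam m c J \<longleftrightarrow> Gam m c J \<subseteq> H" for J
    using card_subset_eq[OF finite_Gam[of m c J, OF assms(3)], of "Gam m c J \<inter> H"]
    by (auto simp: gam_def Int_absorb2)
  show ?thesis
  proof (intro iffI allI impI conjI)
    fix J
    assume max: "maximal_clique ?U H"
    have no_ext: "\<not> intersecting (insert J ?S)" if "v \<in> Gam m c J" "v \<notin> H" for v
      using that max ins[OF that(1)] Gam_subset_pverts[of m c J]
      by (auto simp: maximal_clique_iff_no_insert)
    \<comment> \<open>For \<open>J\<close> in the support, \<open>insert J ?S\<close> is
      \<open>?S\<close> itself, which is intersecting, so \<open>no_ext\<close> leaves no vertex of
      \<open>Gam m c J\<close> outside \<open>H\<close>.\<close>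
    show "card (Gam m c J \<inter> H) = gam m c J" if "J \<in> ?S"
      using no_ext S that by (auto simp: full insert_absorb)
    \<comment> \<open>For \<open>J\<close> outside the support, \<open>Gam m c J\<close> is disjoint
      from \<open>H\<close>, so \<open>no_ext\<close> applies to any of its vertices.\<close>
    show "Gam m c J = {} \<or> (Gam m c J \<noteq> {} \<and> \<not> intersecting ({J} \<union> ?S))"
      if "J \<subseteq> {1..m}" "J \<notin> ?S"
      using no_ext that by (auto simp: supp_def)
  next
    assume cond: "\<forall>J. J \<subseteq> {1..m} \<longrightarrow>
      (J \<in> ?S \<longrightarrow> card (Gam m c J \<inter> H) = gam m c J) \<and>
      (J \<notin> ?S \<longrightarrow> Gam m c J = {} \<or> (Gam m c J \<noteq> {} \<and> \<not> intersecting ({J} \<union> ?S)))"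
    have "\<not> clique ?U (insert v H)" if v: "v \<in> pverts ?U - H" for v
    proof -
      define J where "J = {j \<in> {1..m}. v \<in> c j}"
      have vJ: "v \<in> Gam m c J" and J: "J \<subseteq> {1..m}"
        using v Gam_index_set[of v m c] by (auto simp: J_def)
      \<comment> \<open>Were \<open>J\<close> in the support, the first condition would put all of
        \<open>Gam m c J\<close>, hence \<open>v\<close>, into \<open>H\<close>. So the second
        condition applies, and \<open>v\<close> witnesses that \<open>Gam m c J\<close> is
        nonempty.\<close>
      have "J \<notin> ?S" using cond J v vJ by (auto simp: full)
      then show ?thesis using cond J vJ by (auto simp: ins[OF vJ])
    qed
    then show "maximal_clique ?U H" using assms(5) by (simp add: maximal_clique_iff_no_insert)
  qed
qed

end
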